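(* Let $\mu$ be the Borel measure on $(0,+\infty)$ associated to the geometric mean, i.e. the measure with $\mu([a,b])=\frac{1}{e^2}\left(\frac{1}{\sqrt{a}}-\frac{1}{\sqrt{b}}\right)$ for all $0<a<b$. If $H\in\mathrm{Dom}(\mathcal{M}^{\mu})$, then $\mathcal{M}^{\mu}(H)\le \mathrm{Avg}(H)$.
   Context: $\mathrm{Dom}(\mathcal{M}^{\mu})$ is the family of bounded $\mu$-measurable sets $H\subset(0,+\infty)$ with $0<\mu(H)<+\infty$, and $\mathcal{M}^{\mu}(H)=\frac{\int_H x\,d\mu}{\mu(H)}$ for such $H$ ($\mu$-measurable means measurable with respect to the completion of $\mu$). The measure $\mu$ satisfies $\mathcal{M}^{\mu}([a,b])=\sqrt{ab}$ for $0<a<b$. $\lambda$ denotes the Lebesgue measure, and for a bounded Lebesgue measurable $H$ with $\lambda(H)>0$, $\mathrm{Avg}(H)=\frac{\int_H x\,d\lambda}{\lambda(H)}$. *)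

theory Defs
  imports "HOL-Analysis.Analysis"
begin

definition mean_dom :: "real measure \<Rightarrow> real set set" where
  "mean_dom \<mu> =
     {H. H \<subseteq> {0<..} \<and> bounded H \<and> H \<in> sets (completion \<mu>) \<and>
         0 < emeasure (completion \<mu>) H \<and> emeasure (completion \<mu>) H < \<infinity>}"

definition mean_by :: "real measure \<Rightarrow> real set \<Rightarrow> real" where
  "mean_by \<mu> H = (LINT x:H|completion \<mu>. x) / measure (completion \<mu>) H"

definition avg_dom :: "real set set" where
  "avg_dom = {H. bounded H \<and> H \<in> sets lebesgue \<and> 0 < emeasure lebesgue H}"

definition avg :: "real set \<Rightarrow> real" where
  "avg H = (LINT x:H|lebesgue. x) / measure lebesgue H"

(* The space of the measure is the open half-line itself; a measure with these
   values on compact intervals is unique. *)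
definition geometric_mean_measure :: "real measure \<Rightarrow> bool" where
  "geometric_mean_measure \<mu> \<longleftrightarrow>
     sets \<mu> = sets (restrict_space borel {0<..}) \<and>
     (\<forall>a b. 0 < a \<longrightarrow> a < b \<longrightarrow>
        emeasure \<mu> {a..b} = ennreal (1 / (exp 1)^2 * (1 / sqrt a - 1 / sqrt b)))"

end

theory Submission
  imports Defs
begin

text \<open>
  The measure \<open>\<mu>\<close> has the density \<open>x powr (-3/2) / (2 * exp 1 ^ 2)\<close> with respect to the Lebesgue
  measure: both sides give the same values to compact intervals, and these values determine a
  measure on the half-line (\<open>halfline_measure_eqI\<close>). Everything then rests on the density being
  positive and decreasing.

  Positivity makes the null sets of \<open>\<mu>\<close> Lebesgue null. A set of the completion of \<open>\<mu>\<close> is therefore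
  Lebesgue measurable, and one Borel set may replace it in the means for both measures.

  Monotonicity gives the inequality, which is Chebyshev's: a decreasing weight puts more mass on
  small values and so lowers the mean (\<open>weighted_mean_le_mean\<close>).
\<close>

section \<open>Decreasing weights lower the mean\<close>

text \<open>
  Let \<open>m\<close> be the unweighted mean. Since \<open>w\<close> is decreasing, \<open>(x - m) * (w x - w m) \<le> 0\<close>. Integration
  over \<open>S\<close> bounds the integral of \<open>(x - m) * w x\<close> by \<open>w m\<close> times the integral of \<open>x - m\<close>, which is
  zero.
\<close>

lemma weighted_mean_le_mean:
  fixes w :: "real \<Rightarrow> real"
  assumes S: "S \<in> sets borel" "bounded S" "S \<subseteq> {0<..}" "0 < measure lborel S"
    and w: "antimono_on {0<..} w" "set_integrable lborel S w" "0 < (LINT x:S|lborel. w x)"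
  shows "(LINT x:S|lborel. x * w x) / (LINT x:S|lborel. w x)
           \<le> (LINT x:S|lborel. x) / measure lborel S"
proof -
  define m where "m = (LINT x:S|lborel. x) / measure lborel S"
  obtain B where B: "\<And>x. x \<in> S \<Longrightarrow> \<bar>x\<bar> \<le> B"
    using S(2) unfolding bounded_iff by auto
  have fin: "emeasure lborel S < \<infinity>"
    using emeasure_bounded_finite[OF S(2)] by (simp add: top.not_eq_extremum)
  have int1: "set_integrable lborel S (\<lambda>_. 1 :: real)"
    using S(1) fin by (simp add: set_integrable_def)
  have intx: "set_integrable lborel S (\<lambda>x. x)"
  proof (rule set_integrable_bound[where f = "\<lambda>_. B"])
    show "set_integrable lborel S (\<lambda>_. B)"
      using S(1) fin by (simp add: set_integrable_def)
    show "set_borel_measurable lborel S (\<lambda>x. x)"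
      using S(1) by (simp add: set_borel_measurable_def)
    show "AE x in lborel. x \<in> S \<longrightarrow> norm x \<le> norm B"
      using B by (intro AE_I2) fastforce
  qed
  have intxw: "set_integrable lborel S (\<lambda>x. x * w x)"
  proof (rule set_integrable_bound[where f = "\<lambda>x. B * w x"])
    show "set_integrable lborel S (\<lambda>x. B * w x)"
      using w(2) by simp
    have "(\<lambda>x. x * (indicator S x *\<^sub>R w x)) \<in> borel_measurable lborel"
      using w(2) unfolding set_integrable_def by measurable
    then show "set_borel_measurable lborel S (\<lambda>x. x * w x)"
      by (simp add: set_borel_measurable_def mult_ac)
    show "AE x in lborel. x \<in> S \<longrightarrow> norm (x * w x) \<le> norm (B * w x)"
      using B by (intro AE_I2) (auto simp: abs_mult intro!: mult_right_mono order_trans[OF B])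
  qed
  have meas: "(LINT x:S|lborel. 1) = measure lborel S"
    using S(1) fin by (simp add: set_lebesgue_integral_def)
  have mint: "(LINT x:S|lborel. x) = m * measure lborel S"
    using S(4) by (simp add: m_def)
  \<comment> \<open>This puts \<open>m\<close> in the domain on which \<open>w\<close> is monotone.\<close>
  have "0 < m"
  proof -
    have "(LINT x:S|lborel. x) \<noteq> 0"
    proof
      assume "(LINT x:S|lborel. x) = 0"
      moreover have "AE x in lborel. 0 \<le> indicator S x *\<^sub>R x"
        using S(3) by (intro AE_I2) (auto simp: indicator_def)
      ultimately have "AE x in lborel. indicator S x *\<^sub>R x = 0"
        using intx unfolding set_integrable_def set_lebesgue_integral_def
        by (simp add: integral_nonneg_eq_0_iff_AE)
      then have "AE x in lborel. x \<notin> S"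
        by eventually_elim (use S(3) in \<open>auto simp: indicator_def split: if_splits\<close>)
      then have "S \<in> null_sets lborel"
        using S(1) by (subst AE_iff_null_sets) auto
      then show False
        using S(4) by (simp add: measure_def null_sets_def)
    qed
    moreover have "0 \<le> (LINT x:S|lborel. x)"
      unfolding set_lebesgue_integral_def
      using S(3) by (intro integral_nonneg_AE AE_I2) (auto simp: indicator_def)
    ultimately show ?thesis
      using S(4) by (simp add: m_def)
  qed
  have pointwise: "x * w x - m * w x \<le> w m * x - w m * m" if "x \<in> S" for x
  proof -
    have "0 < x" using that S(3) by auto
    have "(x - m) * (w x - w m) \<le> 0"
    proof (cases "x \<le> m")
      case True
      then have "w m \<le> w x"
        using w(1) \<open>0 < x\<close> \<open>0 < m\<close> by (simp add: monotone_on_def)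
      with True show ?thesis
        by (simp add: mult_nonpos_nonneg)
    next
      case False
      then have "w x \<le> w m"
        using w(1) \<open>0 < x\<close> \<open>0 < m\<close> by (simp add: monotone_on_def)
      with False show ?thesis
        by (simp add: mult_nonneg_nonpos)
    qed
    then show ?thesis
      by (simp add: algebra_simps)
  qed
  have "(LINT x:S|lborel. x * w x) - m * (LINT x:S|lborel. w x)
        = (LINT x:S|lborel. x * w x - m * w x)"
    using intxw w(2) by (simp add: set_integral_diff)
  also have "\<dots> \<le> (LINT x:S|lborel. w m * x - w m * m)"
  proof (rule set_integral_mono)
    show "set_integrable lborel S (\<lambda>x. x * w x - m * w x)"
      using intxw w(2) by (intro set_integral_diff(1)) auto
    show "set_integrable lborel S (\<lambda>x. w m * x - w m * m)"
      using intx set_integrable_mult_right[of "w m * m", OF int1]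
      by (intro set_integral_diff(1)) auto
  qed (rule pointwise)
  also have "\<dots> = w m * (LINT x:S|lborel. x) - w m * m * (LINT x:S|lborel. 1)"
    using set_integral_diff(2)[of lborel S "\<lambda>x. w m * x" "\<lambda>x. w m * m * 1"]
      intx set_integrable_mult_right[of "w m * m", OF int1]
      set_integral_mult_right[of lborel S "w m * m" "\<lambda>_. 1"]
    by simp
  also have "\<dots> = 0"
    by (simp add: meas mint)
  finally show ?thesis
    using w(3) by (simp add: m_def[symmetric] pos_divide_le_eq)
qed

section \<open>Sets measurable for a completion\<close>

text \<open>
  Together these let a set \<open>S\<close> of \<open>M\<close> stand for a set of the completion in the measure as well as
  in the integral. They are applied to one decomposition of a set under two different measures.
\<close>

lemma completion_Un_null_part:
  assumes "S \<in> sets M" "N \<subseteq> N'" "N' \<in> null_sets M"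
  shows "S \<union> N \<in> sets (completion M)"
    and "emeasure (completion M) (S \<union> N) = emeasure M S"
proof -
  have N: "N \<in> null_sets (completion M)"
    using assms(2,3) by (metis null_sets_completion_subset null_sets_completionI)
  then show "S \<union> N \<in> sets (completion M)"
    using assms(1) by auto
  show "emeasure (completion M) (S \<union> N) = emeasure M S"
    using N assms(1) by (simp add: emeasure_Un_null_set)
qed

lemma set_integral_completion_Un_null_part:
  fixes g :: "'a \<Rightarrow> real"
  assumes "S \<in> sets M" "N \<subseteq> N'" "N' \<in> null_sets M" and g: "g \<in> borel_measurable M"
  shows "(LINT x:S \<union> N|completion M. g x) = (LINT x:S|M. g x)"
proof -
  have gc: "g \<in> borel_measurable (completion M)"
    using g by (rule measurable_completion)
  have sets: "S \<in> sets (completion M)" "S \<union> N \<in> sets (completion M)"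
    using assms(1) completion_Un_null_part(1)[OF assms(1-3)] by auto
  have "AE x in completion M. x \<notin> N'"
    using assms(3) by (intro AE_not_in) (rule null_sets_completionI)
  then have "AE x in completion M. (x \<in> S \<union> N) = (x \<in> S)"
    by eventually_elim (use assms(2) in auto)
  then have "AE x in completion M. indicator (S \<union> N) x *\<^sub>R g x = indicator S x *\<^sub>R g x"
    by eventually_elim (auto simp: indicator_def)
  then have "(LINT x:S \<union> N|completion M. g x) = (LINT x:S|completion M. g x)"
    unfolding set_lebesgue_integral_def using gc sets by (intro integral_cong_AE) auto
  also have "\<dots> = (LINT x:S|M. g x)"
    unfolding set_lebesgue_integral_def using g assms(1) by (intro integral_completion) simp
  finally show ?thesis .
qed

section \<open>Measures on the half-line\<close>

text \<open>
  Compact intervals of positive length are not closed under intersection, since two of them may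
  share just one point. The half-open intervals are, they generate the Borel sets of the half-line,
  and each is an increasing union of compact intervals of positive length.
\<close>

lemma halfline_measure_eqI:
  fixes M N :: "real measure"
  assumes M: "sets M = sets (restrict_space borel {0<..})"
    and N: "sets N = sets (restrict_space borel {0<..})"
    and eq: "\<And>a b. 0 < a \<Longrightarrow> a < b \<Longrightarrow> emeasure M {a..b} = emeasure N {a..b}"
    and fin: "\<And>a b. 0 < a \<Longrightarrow> a < b \<Longrightarrow> emeasure M {a..b} \<noteq> \<infinity>"
  shows "M = N"
proof -
  let ?\<Omega> = "{0<..} :: real set"
  let ?E = "(\<lambda>(a, b). {max a 0<..b}) ` UNIV :: real set set"
  have sets_iff: "A \<in> sets (restrict_space borel ?\<Omega>) \<longleftrightarrow> A \<in> sets borel \<and> A \<subseteq> ?\<Omega>"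
    for A :: "real set"
    by (subst sets_restrict_space_iff) auto
  have gen: "sets (restrict_space borel ?\<Omega>) = sigma_sets ?\<Omega> ?E"
  proof -
    have "sets (restrict_space borel ?\<Omega>)
          = (\<inter>) ?\<Omega> ` sigma_sets UNIV (range (\<lambda>(a, b). {a<..b :: real}))"
      by (simp add: sets_restrict_space borel_sigma_sets_Ioc)
    also have "\<dots> = sigma_sets ?\<Omega> ((\<inter>) ?\<Omega> ` range (\<lambda>(a, b). {a<..b :: real}))"
    proof (rule sigma_sets_Int)
      show "?\<Omega> \<in> sigma_sets UNIV (range (\<lambda>(a, b). {a<..b :: real}))"
        by (metis borel_open borel_sigma_sets_Ioc open_greaterThan sets_measure_of top_greatest
              Pow_UNIV)
    qed simp
    also have "(\<inter>) ?\<Omega> ` range (\<lambda>(a, b). {a<..b :: real}) = ?E"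
      by (subst image_image, rule image_cong) auto
    finally show ?thesis .
  qed
  have half_open: "emeasure M {a<..b} = emeasure N {a<..b}" if "0 \<le> a" for a b
  proof (cases "a < b")
    case True
    \<comment> \<open>The \<open>2\<close> keeps the left end point below \<open>b\<close> at \<open>n = 0\<close>.\<close>
    define A where "A n = {a + (b - a) / (real n + 2)..b}" for n
    have lo: "0 < a + (b - a) / (real n + 2)" "a + (b - a) / (real n + 2) < b" for n
    proof -
      show "0 < a + (b - a) / (real n + 2)"
        using True that by (intro add_nonneg_pos divide_pos_pos) auto
      have "(b - a) / (real n + 2) < (b - a) / 1"
        using True by (intro divide_strict_left_mono) auto
      then show "a + (b - a) / (real n + 2) < b" by simp
    qed
    have inc: "incseq A"
      unfolding A_def using True by (intro monoI) (auto intro!: divide_left_mono)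
    have un: "(\<Union>n. A n) = {a<..b}"
    proof (intro equalityI subsetI)
      fix x assume "x \<in> (\<Union>n. A n)"
      then obtain n where "a + (b - a) / (real n + 2) \<le> x" "x \<le> b"
        by (auto simp: A_def)
      moreover have "0 < (b - a) / (real n + 2)" using True by simp
      ultimately show "x \<in> {a<..b}" by simp
    next
      fix x assume x: "x \<in> {a<..b}"
      obtain n where n: "(b - a) / (x - a) < real n"
        using reals_Archimedean2 by blast
      have "b - a < real n * (x - a)"
        using n x by (simp add: pos_divide_less_eq)
      also have "\<dots> \<le> (real n + 2) * (x - a)"
        using x by (intro mult_right_mono) auto
      finally have "(b - a) / (real n + 2) \<le> x - a"
        by (simp add: pos_divide_le_eq mult.commute)
      with x have "x \<in> A n" by (simp add: A_def)
      then show "x \<in> (\<Union>n. A n)" by blast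
    qed
    have "A n \<in> sets (restrict_space borel ?\<Omega>)" for n
      unfolding sets_iff A_def using lo(1)[of n] by auto
    then have "range A \<subseteq> sets M" "range A \<subseteq> sets N"
      by (auto simp: M N)
    then have "(SUP n. emeasure M (A n)) = emeasure M (\<Union>n. A n)"
      "(SUP n. emeasure N (A n)) = emeasure N (\<Union>n. A n)"
      using inc by (simp_all add: SUP_emeasure_incseq)
    moreover have "emeasure M (A n) = emeasure N (A n)" for n
      unfolding A_def using lo by (rule eq)
    ultimately have "emeasure M (\<Union>n. A n) = emeasure N (\<Union>n. A n)"
      by simp
    then show ?thesis by (simp add: un)
  qed simp
  show ?thesis
  proof (rule measure_eqI_generator_eq[where \<Omega> = ?\<Omega> and E = ?E and
        A = "\<lambda>n. {1 / (real n + 1)<..real n + 2}"])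
    show "Int_stable ?E"
    proof (rule Int_stableI)
      fix X Y assume "X \<in> ?E" "Y \<in> ?E"
      then obtain a b c d where "X = {max a 0<..b}" "Y = {max c 0<..d}"
        by auto
      then have "X \<inter> Y = {max (max a c) 0<..min b d}" by auto
      then show "X \<inter> Y \<in> ?E"
        by (intro image_eqI[of _ _ "(max a c, min b d)"]) auto
    qed
    show "?E \<subseteq> Pow ?\<Omega>" by auto
    show "emeasure M X = emeasure N X" if "X \<in> ?E" for X
      using that half_open by auto
    show "sets M = sigma_sets ?\<Omega> ?E" "sets N = sigma_sets ?\<Omega> ?E"
      by (simp_all add: M N gen)
    show "range (\<lambda>n. {1 / (real n + 1)<..real n + 2}) \<subseteq> ?E"
    proof clarify
      fix n
      have "max (1 / (real n + 1)) 0 = 1 / (real n + 1)" by simp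
      then show "{1 / (real n + 1)<..real n + 2} \<in> ?E"
        by (intro image_eqI[of _ _ "(1 / (real n + 1), real n + 2)"]) auto
    qed
    show "(\<Union>n. {1 / (real n + 1)<..real n + 2}) = ?\<Omega>"
    proof (intro equalityI subsetI)
      fix x :: real assume "x \<in> (\<Union>n. {1 / (real n + 1)<..real n + 2})"
      then obtain n where "1 / (real n + 1) < x" by auto
      with order.strict_trans[of 0 "1 / (real n + 1)" x] show "x \<in> ?\<Omega>" by simp
    next
      fix x :: real assume "x \<in> ?\<Omega>"
      then have x: "0 < x" by simp
      obtain n where n: "max (1 / x) x < real n"
        using reals_Archimedean2 by blast
      have "1 < real n * x"
        using n x by (simp add: pos_divide_less_eq)
      also have "\<dots> \<le> (real n + 1) * x"
        using x by (intro mult_right_mono) auto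
      finally have "1 / (real n + 1) < x"
        by (simp add: pos_divide_less_eq mult.commute)
      with n show "x \<in> (\<Union>n. {1 / (real n + 1)<..real n + 2})"
        by (intro UN_I[of n]) auto
    qed
    fix n
    have pos: "0 < 1 / (real n + 1)" "1 / (real n + 1) < real n + 2"
      by (simp_all add: pos_divide_less_eq algebra_simps add_strict_increasing2)
    have "{1 / (real n + 1)..real n + 2} \<in> sets M"
      unfolding M sets_iff using order.strict_trans2[OF pos(1)] by auto
    then have "emeasure M {1 / (real n + 1)<..real n + 2}
               \<le> emeasure M {1 / (real n + 1)..real n + 2}"
      by (intro emeasure_mono) auto
    with fin[OF pos] show "emeasure M {1 / (real n + 1)<..real n + 2} \<noteq> \<infinity>"
      by (auto simp: top_unique)
  qed
qed

section \<open>The density of the geometric mean measure\<close>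

definition geometric_density :: "real \<Rightarrow> real" where
  "geometric_density x = x powr (-3/2) / (2 * (exp 1)^2)"

lemma geometric_density_pos: "0 < x \<Longrightarrow> 0 < geometric_density x"
  by (simp add: geometric_density_def)

lemma geometric_density_nonneg: "0 \<le> geometric_density x"
  by (simp add: geometric_density_def)

lemma antimono_on_geometric_density: "antimono_on {0<..} geometric_density"
  by (intro monotone_onI)
    (auto simp: geometric_density_def intro!: divide_right_mono powr_mono2')

lemma borel_measurable_geometric_density [measurable]:
  "geometric_density \<in> borel_measurable borel"
  unfolding geometric_density_def by measurable

lemma nn_integral_geometric_density_Icc:
  assumes "0 < a" "a < b"
  shows "(\<integral>\<^sup>+x\<in>{a..b}. ennreal (geometric_density x) \<partial>lborel)
         = ennreal (1 / (exp 1)^2 * (1 / sqrt a - 1 / sqrt b))"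
proof -
  define F :: "real \<Rightarrow> real" where "F x = - (x powr (-1/2)) / (exp 1)^2" for x
  have F_sqrt: "F x = - (1 / sqrt x) / (exp 1)^2" if "0 < x" for x :: real
    using that by (simp add: F_def powr_minus_divide powr_half_sqrt)
  have "(\<integral>\<^sup>+x\<in>{a..b}. ennreal (geometric_density x) \<partial>lborel) = ennreal (F b - F a)"
  proof (rule nn_integral_FTC_Icc)
    fix x assume "x \<in> {a..b}"
    then have "0 < x" using assms by simp
    then have "((\<lambda>x. - (x powr (-1/2))) has_real_derivative
               - (-1/2 * x powr (-1/2 - 1))) (at x)"
      by (auto intro!: derivative_eq_intros)
    from DERIV_cdivide[OF this, of "(exp 1)^2"]
    show "(F has_real_derivative geometric_density x) (at x)"
      unfolding F_def geometric_density_def by simp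
  qed (use assms geometric_density_nonneg in auto)
  also have "F b - F a = 1 / (exp 1)^2 * (1 / sqrt a - 1 / sqrt b)"
    using assms by (simp add: F_sqrt algebra_simps diff_divide_distrib)
  finally show ?thesis .
qed

lemma geometric_mean_measure_eq_density:
  assumes "geometric_mean_measure \<mu>"
  shows "\<mu> = restrict_space (density lborel (\<lambda>x. ennreal (geometric_density x))) {0<..}"
proof (rule halfline_measure_eqI)
  let ?D = "density lborel (\<lambda>x. ennreal (geometric_density x))"
  show "sets \<mu> = sets (restrict_space borel {0<..})"
    using assms by (simp add: geometric_mean_measure_def)
  show "sets (restrict_space ?D {0<..}) = sets (restrict_space borel {0<..})"
    by (simp add: sets_restrict_space)
  fix a b :: real assume ab: "0 < a" "a < b"
  have \<mu>: "emeasure \<mu> {a..b} = ennreal (1 / (exp 1)^2 * (1 / sqrt a - 1 / sqrt b))"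
    using assms ab unfolding geometric_mean_measure_def by blast
  then show "emeasure \<mu> {a..b} \<noteq> \<infinity>" by simp
  have "emeasure (restrict_space ?D {0<..}) {a..b} = emeasure ?D {a..b}"
    using ab by (subst emeasure_restrict_space) auto
  also have "\<dots> = (\<integral>\<^sup>+x\<in>{a..b}. ennreal (geometric_density x) \<partial>lborel)"
    by (simp add: emeasure_density)
  also have "\<dots> = emeasure \<mu> {a..b}"
    using nn_integral_geometric_density_Icc[OF ab] by (simp add: \<mu>)
  finally show "emeasure \<mu> {a..b} = emeasure (restrict_space ?D {0<..}) {a..b}" ..
qed

theorem theorem3p10:
  fixes \<mu> :: "real measure" and H :: "real set"
  assumes "geometric_mean_measure \<mu>"
    and "H \<in> mean_dom \<mu>"
  shows "H \<in> avg_dom \<and> mean_by \<mu> H \<le> avg H"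
proof -
  let ?w = geometric_density
  let ?D = "density lborel (\<lambda>x. ennreal (?w x))"
  have \<mu>_eq: "\<mu> = restrict_space ?D {0<..}"
    using assms(1) by (rule geometric_mean_measure_eq_density)
  have sets_\<mu>: "A \<in> sets \<mu> \<longleftrightarrow> A \<in> sets borel \<and> A \<subseteq> {0<..}" for A
    unfolding \<mu>_eq by (subst sets_restrict_space_iff) auto
  have em_\<mu>: "emeasure \<mu> A = emeasure ?D A" if "A \<in> sets \<mu>" for A
    using that unfolding \<mu>_eq sets_\<mu>[unfolded \<mu>_eq]
    by (subst emeasure_restrict_space) auto
  have int_\<mu>: "(LINT x:A|\<mu>. x) = (LINT x:A|lborel. x * ?w x)" if A: "A \<in> sets \<mu>" for A
  proof -
    have [measurable]: "A \<in> sets borel" and "A \<subseteq> {0<..}"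
      using A by (auto simp: sets_\<mu>)
    have "(LINT x:A|\<mu>. x) = (LINT x|?D. indicator {0<..} x *\<^sub>R indicator A x *\<^sub>R x)"
      unfolding set_lebesgue_integral_def \<mu>_eq by (subst integral_restrict_space) auto
    also have "\<dots> = (LINT x|?D. indicator A x *\<^sub>R x)"
      using \<open>A \<subseteq> {0<..}\<close> by (intro Bochner_Integration.integral_cong) (auto simp: indicator_def)
    also have "\<dots> = (LINT x|lborel. ?w x *\<^sub>R (indicator A x *\<^sub>R x))"
      by (intro integral_density) (auto simp: geometric_density_nonneg)
    also have "\<dots> = (LINT x:A|lborel. x * ?w x)"
      by (simp add: set_lebesgue_integral_def mult_ac)
    finally show ?thesis .
  qed
  have null: "A \<in> null_sets lborel" if "A \<in> null_sets \<mu>" for A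
  proof -
    have A: "A \<in> sets \<mu>" "A \<in> null_sets ?D"
      using that em_\<mu>[of A] by (auto simp: null_sets_def sets_\<mu>)
    then have "AE x in lborel. x \<in> A \<longrightarrow> ennreal (?w x) = 0"
      by (subst (asm) null_sets_density_iff) auto
    then have "AE x in lborel. x \<notin> A"
    proof eventually_elim
      case (elim x)
      then show ?case
        using A(1) geometric_density_pos[of x] by (auto simp: sets_\<mu> ennreal_eq_0_iff)
    qed
    then show ?thesis
      using A(1) by (subst AE_iff_null_sets) (auto simp: sets_\<mu>)
  qed
  have H: "bounded H" "H \<in> sets (completion \<mu>)" "0 < emeasure (completion \<mu>) H"
      "emeasure (completion \<mu>) H < \<infinity>"
    using assms(2) by (auto simp: mean_dom_def)
  \<comment> \<open>By \<open>null\<close>, this decomposition of \<open>H\<close> is also one for the Lebesgue measure.\<close>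
  from H(2) obtain S N N' where SN: "H = S \<union> N" "N \<subseteq> N'" "N' \<in> null_sets \<mu>" "S \<in> sets \<mu>"
    by (rule sets_completionE)
  have S: "S \<in> sets borel" "S \<subseteq> {0<..}" "bounded S"
    using SN(1,4) H(1) by (auto simp: sets_\<mu> intro: bounded_subset)
  have Sl: "S \<in> sets lborel" and N'l: "N' \<in> null_sets lborel"
    using S(1) null[OF SN(3)] by auto
  have em_H: "emeasure (completion \<mu>) H = emeasure ?D S"
    using completion_Un_null_part(2)[OF SN(4,2,3)] em_\<mu>[OF SN(4)] SN(1) by simp
  have em_int: "emeasure ?D S = (\<integral>\<^sup>+x. ennreal (indicator S x *\<^sub>R ?w x) \<partial>lborel)"
    using S(1) by (subst emeasure_density)
      (auto intro!: nn_integral_cong simp: indicator_def)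
  \<comment> \<open>The weight is not integrable near \<open>0\<close>; over \<open>S\<close> it is, because \<open>\<mu>\<close> gives \<open>H\<close> finite mass.\<close>
  have w_int: "set_integrable lborel S ?w"
    unfolding set_integrable_def
    by (rule integrableI_nonneg)
      (use S(1) H(4) em_H em_int geometric_density_nonneg in auto)
  have em_w: "emeasure ?D S = ennreal (LINT x:S|lborel. ?w x)"
    unfolding em_int set_lebesgue_integral_def
    using w_int by (intro nn_integral_eq_integral)
      (auto simp: set_integrable_def geometric_density_nonneg)
  have w_pos: "0 < (LINT x:S|lborel. ?w x)"
    using H(3) unfolding em_H em_w by simp
  have lebH: "H \<in> sets lebesgue" "emeasure lebesgue H = emeasure lborel S"
    using completion_Un_null_part[OF Sl SN(2) N'l] SN(1) by auto
  have "emeasure lborel S \<noteq> 0"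
  proof
    assume "emeasure lborel S = 0"
    then have "AE x in lborel. x \<notin> S"
      using S(1) by (intro AE_not_in) auto
    then have "AE x in lborel. indicator S x *\<^sub>R ?w x = 0"
      by eventually_elim simp
    then have "(LINT x:S|lborel. ?w x) = 0"
      unfolding set_lebesgue_integral_def by (rule integral_eq_zero_AE)
    with w_pos show False by simp
  qed
  then have lamS: "0 < emeasure lborel S" by (simp add: zero_less_iff_neq_zero)
  have "0 < measure lborel S"
    using lamS emeasure_bounded_finite[OF S(3)]
    by (simp add: measure_def enn2real_positive_iff)
  then have ineq: "(LINT x:S|lborel. x * ?w x) / (LINT x:S|lborel. ?w x)
           \<le> (LINT x:S|lborel. x) / measure lborel S"
    using S w_int w_pos antimono_on_geometric_density by (intro weighted_mean_le_mean)
  have "(\<lambda>x. x) \<in> borel_measurable \<mu>"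
    unfolding \<mu>_eq by (intro measurable_restrict_space1) simp
  then have "mean_by \<mu> H = (LINT x:S|lborel. x * ?w x) / (LINT x:S|lborel. ?w x)"
    using set_integral_completion_Un_null_part[OF SN(4,2,3)] int_\<mu>[OF SN(4)] em_H em_w w_pos SN(1)
    by (simp add: mean_by_def measure_def)
  moreover have "avg H = (LINT x:S|lborel. x) / measure lborel S"
    using set_integral_completion_Un_null_part[OF Sl SN(2) N'l, of "\<lambda>x. x"] lebH(2) SN(1)
    by (simp add: avg_def measure_def)
  ultimately show ?thesis
    using ineq H(1) lebH lamS by (simp add: avg_dom_def)
qed

end
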